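(* Among all bicyclic configurations $P$, $$\min_P\bigl(e(P)+s(P)\bigr)=11 .$$ Up to relabeling colors and interchanging rows with columns, equality occurs in exactly two ways: (1) $P=R\times K$ (so $P\cong K_{2,3}$), where $|R|=2$, $|K|=3$ and $R\cap K=\varnothing$; (2) $R=\{a,b,x\}$ and $K=\{a,b,y\}$, where $a\ne b$, $x\neq y$ and $x,y\notin\{a,b\}$, and $P=(R\times K)\setminus\{(a,a),(b,b)\}$.
   Context: A two-spine configuration is a finite set $P$ of ordered pairs $(x,y)$ of distinct colors (colors drawn from any finite set). It is viewed as a bipartite graph: $(x,y)\in P$ is an edge from the row copy of $x$ to the column copy of $y$; row $c$ and column $c$ are distinct vertices. Let $R(P)$ be the set of colors occurring as first coordinates (row colors) and $K(P)$ the set occurring as second coordinates (column colors) of pairs in $P$; the vertex set of the graph is the disjoint union of row copies of $R(P)$ and column copies of $K(P)$. Put $e(P)=|P|$, $v(P)=|R(P)|+|K(P)|$, and $s(P)=|R(P)\cup K(P)|$. A bicyclic configuration is a two-spine configuration $P$ that is connected as a graph and satisfies $e(P)=v(P)+1$. In the claim, $R=R(P)$ and $K=K(P)$. Interchanging rows with columns means replacing $P$ by $\{(y,x):(x,y)\in P\}$. *)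

theory Defs
  imports "Graph_Theory.Digraph_Component"
begin

text \<open>
  A configuration is a finite set of pairs over an arbitrary colour type; the finite set of
  colours it is drawn from can be taken to be the set of colours that occur.
\<close>

definition two_spine_config :: "('a \<times> 'a) set \<Rightarrow> bool" where
  "two_spine_config P \<longleftrightarrow> finite P \<and> (\<forall>(x, y) \<in> P. x \<noteq> y)"

definition row_colors :: "('a \<times> 'a) set \<Rightarrow> 'a set" where
  "row_colors P = fst ` P"

definition col_colors :: "('a \<times> 'a) set \<Rightarrow> 'a set" where
  "col_colors P = snd ` P"

definition num_edges :: "('a \<times> 'a) set \<Rightarrow> nat" where
  "num_edges P = card P"

definition num_verts :: "('a \<times> 'a) set \<Rightarrow> nat" where
  "num_verts P = card (row_colors P) + card (col_colors P)"

definition num_colors :: "('a \<times> 'a) set \<Rightarrow> nat" where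
  "num_colors P = card (row_colors P \<union> col_colors P)"

text \<open>
  The bipartite graph of a configuration: \<open>Inl c\<close> is row \<open>c\<close> and \<open>Inr c\<close> is column \<open>c\<close>.
  Every edge is stored as one arc, from its row to its column. The predicate \<^const>\<open>connected\<close>
  refers to the underlying undirected graph, so this orientation is immaterial.
\<close>

definition config_graph :: "('a \<times> 'a) set \<Rightarrow> ('a + 'a) pair_pre_digraph" where
  "config_graph P =
     \<lparr> pverts = row_colors P <+> col_colors P,
       parcs = (\<lambda>(x, y). (Inl x, Inr y)) ` P \<rparr>"

definition bicyclic :: "('a \<times> 'a) set \<Rightarrow> bool" where
  "bicyclic P \<longleftrightarrow>
     two_spine_config P \<and> connected (with_proj (config_graph P)) \<and> num_edges P = num_verts P + 1"

definition relabel :: "('a \<Rightarrow> 'b) \<Rightarrow> ('a \<times> 'a) set \<Rightarrow> ('b \<times> 'b) set" where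
  "relabel f P = map_prod f f ` P"

text \<open>
  Equality up to relabeling colours and interchanging rows with columns. The relabeling acts
  simultaneously on rows and columns and only has to be injective on the colours that occur.
  The two configurations may live over different colour types.
\<close>

definition config_equiv :: "('a \<times> 'a) set \<Rightarrow> ('b \<times> 'b) set \<Rightarrow> bool" where
  "config_equiv P Q \<longleftrightarrow>
     (\<exists>f. inj_on f (row_colors P \<union> col_colors P) \<and> (Q = relabel f P \<or> Q = relabel f (P\<inverse>)))"

definition disjoint_K23 :: "('a \<times> 'a) set \<Rightarrow> bool" where
  "disjoint_K23 P \<longleftrightarrow>
     P = row_colors P \<times> col_colors P \<and>
     card (row_colors P) = 2 \<and> card (col_colors P) = 3 \<and> row_colors P \<inter> col_colors P = {}"

definition K33_minus_two :: "('a \<times> 'a) set \<Rightarrow> bool" where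
  "K33_minus_two P \<longleftrightarrow>
     (\<exists>a b x y. a \<noteq> b \<and> x \<noteq> y \<and> x \<notin> {a, b} \<and> y \<notin> {a, b} \<and>
        row_colors P = {a, b, x} \<and> col_colors P = {a, b, y} \<and>
        P = (row_colors P \<times> col_colors P) - {(a, a), (b, b)})"

end

theory Submission
  imports Defs
begin

text \<open>
  Write \<open>r = |R|\<close>, \<open>k = |K|\<close>, \<open>i = |R \<inter> K|\<close>. A bicyclic configuration has
  \<open>e = r + k + 1\<close> and \<open>s = r + k - i\<close>, and since it avoids the \<open>i\<close> diagonal cells of \<open>R \<times> K\<close>,
  \<open>r + k + 1 + i \<le> r k\<close>, that is, \<open>(r - 1) (k - 1) \<ge> 2 + i\<close>. Together with \<open>i \<le> min r k\<close> this
  forces \<open>e + s = 2 (r + k) + 1 - i \<ge> 11\<close>, with equality only for \<open>(r, k, i)\<close> equal to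
  \<open>(2, 3, 0)\<close>, \<open>(3, 2, 0)\<close> or \<open>(3, 3, 2)\<close>. In each of these cases the cell count is tight, so
  \<open>P\<close> consists of all off-diagonal cells of \<open>R \<times> K\<close>. Connectedness is only needed for the
  converse, where some row and some column of \<open>R \<times> K\<close> are contained in \<open>P\<close>.
\<close>

section \<open>Relabeling, transposition and equivalence of configurations\<close>

lemma row_colors_converse [simp]: "row_colors (P\<inverse>) = col_colors P"
  by (force simp: row_colors_def col_colors_def)

lemma col_colors_converse [simp]: "col_colors (P\<inverse>) = row_colors P"
  by (force simp: row_colors_def col_colors_def)

lemma row_colors_relabel: "row_colors (relabel f P) = f ` row_colors P"
  by (force simp: row_colors_def relabel_def)

lemma col_colors_relabel: "col_colors (relabel f P) = f ` col_colors P"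
  by (force simp: col_colors_def relabel_def)

lemma relabel_converse: "relabel f (P\<inverse>) = (relabel f P)\<inverse>"
  by (force simp: relabel_def)

text \<open>\<open>relabel\<close> evaluates its map only at colors that occur, so an inverse on
  those colors undoes it. This is what makes \<open>config_equiv\<close> symmetric.\<close>

lemma relabel_inv_into:
  assumes "inj_on f (row_colors P \<union> col_colors P)"
  shows "relabel (inv_into (row_colors P \<union> col_colors P) f) (relabel f P) = P"
proof -
  have "map_prod (inv_into (row_colors P \<union> col_colors P) f)
      (inv_into (row_colors P \<union> col_colors P) f) (map_prod f f p) = p" if "p \<in> P" for p
  proof -
    have "fst p \<in> row_colors P" "snd p \<in> col_colors P"
      using that by (auto simp: row_colors_def col_colors_def)
    then show ?thesis using assms by (cases p) (simp add: inv_into_f_f)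
  qed
  then show ?thesis by (simp add: relabel_def image_image)
qed

lemma config_equiv_refl: "config_equiv P P"
  unfolding config_equiv_def relabel_def by (rule exI[of _ id]) (simp add: prod.map_id0)

lemma config_equiv_converse: "config_equiv P (P\<inverse>)"
  unfolding config_equiv_def relabel_def by (rule exI[of _ id]) (simp add: prod.map_id0)

text \<open>Relabeling commutes with transposition and transposition is an involution, so inverting
  \<open>f\<close> on the occurring colors reverses both forms of the equivalence.\<close>

lemma config_equiv_sym:
  assumes "config_equiv P Q"
  shows "config_equiv Q P"
proof -
  obtain f where f: "inj_on f (row_colors P \<union> col_colors P)"
    and Q: "Q = relabel f P \<or> Q = relabel f (P\<inverse>)"
    using assms by (auto simp: config_equiv_def)
  let ?g = "inv_into (row_colors P \<union> col_colors P) f"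
  have colors: "row_colors Q \<union> col_colors Q = f ` (row_colors P \<union> col_colors P)"
    using Q by (auto simp: row_colors_relabel col_colors_relabel)
  have "P = relabel ?g Q \<or> P = relabel ?g (Q\<inverse>)"
    using Q
  proof
    assume "Q = relabel f P"
    then show ?thesis using relabel_inv_into[OF f] by simp
  next
    assume "Q = relabel f (P\<inverse>)"
    then show ?thesis using relabel_inv_into[OF f] by (simp add: relabel_converse)
  qed
  moreover have "inj_on ?g (row_colors Q \<union> col_colors Q)"
    using inj_on_inv_into[OF order_refl] by (simp only: colors)
  ultimately show ?thesis unfolding config_equiv_def by blast
qed

text \<open>Transposition only swaps the two sets in the union of row and column colors, and
  \<open>f\<close> is injective on that union. This invariant later separates the two extremal
  types.\<close>

lemma num_colors_config_equiv:
  assumes "config_equiv P Q"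
  shows "num_colors Q = num_colors P"
proof -
  obtain f where f: "inj_on f (row_colors P \<union> col_colors P)"
    and Q: "Q = relabel f P \<or> Q = relabel f (P\<inverse>)"
    using assms by (auto simp: config_equiv_def)
  have "row_colors Q \<union> col_colors Q = f ` (row_colors P \<union> col_colors P)"
    using Q by (auto simp: row_colors_relabel col_colors_relabel)
  then show ?thesis using f by (simp add: num_colors_def card_image)
qed

section \<open>A criterion for connectedness\<close>

text \<open>Row \<open>x\<close> acts as a hub: every column is adjacent to it because row
  \<open>x\<close> is full, and every row reaches it in two steps through the full column
  \<open>y\<close>.\<close>

lemma connected_config_graphI:
  assumes x: "x \<in> row_colors P" and y: "y \<in> col_colors P"
    and row: "{x} \<times> col_colors P \<subseteq> P" and col: "row_colors P \<times> {y} \<subseteq> P"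
  shows "connected (with_proj (config_graph P))"
proof -
  let ?G = "with_proj (config_graph P)"
  \<comment> \<open>\<open>connected\<close> means strong connectedness of the symmetric closure, so
    all reachability statements concern \<open>?S\<close>.\<close>
  let ?S = "mk_symmetric ?G"
  interpret G: wf_digraph ?G
  proof (rule wf_digraph_wp_iff[THEN iffD2])
    show "pair_wf_digraph (config_graph P)"
      by unfold_locales (force simp: config_graph_def row_colors_def col_colors_def)+
  qed
  have verts: "verts ?S = Inl ` row_colors P \<union> Inr ` col_colors P"
    by (simp add: config_graph_def Plus_def)
  have arc: "Inl u \<rightarrow>\<^bsub>?S\<^esub> Inr v" "Inr v \<rightarrow>\<^bsub>?S\<^esub> Inl u" if "(u, v) \<in> P" for u v
    using that by (force simp: parcs_mk_symmetric config_graph_def)+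
  interpret S: wf_digraph ?S by (rule wf_digraph_wp_iff[THEN iffD2]) (rule G.wellformed_mk_symmetric)
  have hub: "Inl x \<rightarrow>\<^sup>*\<^bsub>?S\<^esub> w \<and> w \<rightarrow>\<^sup>*\<^bsub>?S\<^esub> Inl x" if "w \<in> verts ?S" for w
  proof (cases w)
    case (Inl u)
    then have "u \<in> row_colors P" using that verts by auto
    then have "(u, y) \<in> P" "(x, y) \<in> P" using col x by auto
    then show ?thesis using arc Inl by (meson S.reachable_adjI S.reachable_trans)
  next
    case (Inr v)
    then have "v \<in> col_colors P" using that verts by auto
    then have "(x, v) \<in> P" using row by auto
    then show ?thesis using arc Inr by (meson S.reachable_adjI)
  qed
  show ?thesis
    unfolding connected_def
  proof (rule strongly_connectedI)
    show "verts ?S \<noteq> {}" using x verts by auto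
    show "u \<rightarrow>\<^sup>*\<^bsub>?S\<^esub> v" if "u \<in> verts ?S" "v \<in> verts ?S" for u v
      using hub[OF that(1)] hub[OF that(2)] S.reachable_trans by blast
  qed
qed

section \<open>Counting cells, and the resulting arithmetic\<close>

text \<open>The pairs of \<open>P\<close> are cells of the rectangle \<open>R \<times> K\<close> off
  its diagonal, and that diagonal has one cell for each common color. When the count is tight,
  inclusion becomes equality.\<close>

lemma card_config_le:
  assumes "two_spine_config P"
  shows "card P + card (row_colors P \<inter> col_colors P) \<le> card (row_colors P) * card (col_colors P)"
    and "card P + card (row_colors P \<inter> col_colors P) = card (row_colors P) * card (col_colors P)
      \<Longrightarrow> P = row_colors P \<times> col_colors P - Id_on (row_colors P \<inter> col_colors P)"
proof -
  let ?R = "row_colors P" and ?K = "col_colors P"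
  let ?D = "Id_on (?R \<inter> ?K)"
  have fin: "finite ?R" "finite ?K"
    using assms by (simp_all add: two_spine_config_def row_colors_def col_colors_def)
  have D: "?D = (\<lambda>c. (c, c)) ` (?R \<inter> ?K)" by auto
  have cardD: "card ?D = card (?R \<inter> ?K)"
    unfolding D by (rule card_image) (simp add: inj_on_def)
  have "P \<subseteq> ?R \<times> ?K" by (force simp: row_colors_def col_colors_def)
  moreover have "P \<inter> ?D = {}" using assms by (force simp: two_spine_config_def)
  ultimately have sub: "P \<subseteq> ?R \<times> ?K - ?D" by blast
  have "?D \<subseteq> ?R \<times> ?K" by auto
  then have card: "card (?R \<times> ?K - ?D) + card (?R \<inter> ?K) = card ?R * card ?K"
    using fin cardD card_mono[of "?R \<times> ?K" ?D]
    by (simp add: card_Diff_subset finite_subset[of ?D "?R \<times> ?K"] card_cartesian_product)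
  show "card P + card (?R \<inter> ?K) \<le> card ?R * card ?K"
    using card_mono[OF _ sub] fin card by simp
  show "P = ?R \<times> ?K - ?D" if "card P + card (?R \<inter> ?K) = card ?R * card ?K"
    using card_subset_eq[OF _ sub] fin card that by simp
qed

text \<open>The quantity to bound is \<open>2 * (r + k) + 1 - i\<close>. If \<open>r = 2\<close>,
  \<open>cells\<close> gives \<open>k \<ge> 3 + i\<close>, so it is at least \<open>11 + i\<close>;
  \<open>k = 2\<close> is symmetric. If \<open>r = k = 3\<close>, \<open>cells\<close> gives
  \<open>i \<le> 2\<close>, so it is \<open>13 - i \<ge> 11\<close>. Otherwise
  \<open>2 * i \<le> r + k\<close> and \<open>r + k \<ge> 7\<close> make it exceed 11.\<close>

lemma edge_color_bound:
  fixes r k i s :: nat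
  assumes cells: "r + k + 1 + i \<le> r * k" and colors: "s + i = r + k" and "i \<le> r" "i \<le> k"
  shows "11 \<le> r + k + 1 + s"
    and "r + k + 1 + s = 11 \<Longrightarrow> (r, k, i) \<in> {(2, 3, 0), (3, 2, 0), (3, 3, 2)}"
proof -
  have *: "11 \<le> r + k + 1 + s \<and>
      (r + k + 1 + s = 11 \<longrightarrow> (r, k, i) \<in> {(2, 3, 0), (3, 2, 0), (3, 3, 2)})"
  proof -
    \<comment> \<open>With at most one row or one column, the rectangle has at most
      \<open>r + k\<close> cells, too few for \<open>cells\<close>.\<close>
    have "r \<noteq> 0" "r \<noteq> 1" "k \<noteq> 0" "k \<noteq> 1" using cells by (auto intro: ccontr)
    then consider "r = 2" | "k = 2" | "r = 3" "k = 3" | "r \<ge> 3" "k \<ge> 3" "r + k \<ge> 7" by linarith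
    then show ?thesis using assms by cases auto
  qed
  show "11 \<le> r + k + 1 + s" using * by blast
  show "r + k + 1 + s = 11 \<Longrightarrow> (r, k, i) \<in> {(2, 3, 0), (3, 2, 0), (3, 3, 2)}" using * by blast
qed

section \<open>Explicit forms of the two extremal types and their symmetries\<close>

text \<open>Naming the five colors reduces relabeling to evaluating a map at five points.\<close>

lemma disjoint_K23_iff:
  "disjoint_K23 P \<longleftrightarrow> (\<exists>a b c d e. distinct [a, b, c, d, e] \<and> P = {a, b} \<times> {c, d, e})"
proof
  assume P: "disjoint_K23 P"
  then have prod: "P = row_colors P \<times> col_colors P"
    and disj: "row_colors P \<inter> col_colors P = {}"
    and card: "card (row_colors P) = 2" "card (col_colors P) = 3"
    unfolding disjoint_K23_def by blast+
  obtain a b where R: "row_colors P = {a, b}" "a \<noteq> b" using card by (auto simp: card_2_iff)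
  obtain c d e where K: "col_colors P = {c, d, e}" "c \<noteq> d" "c \<noteq> e" "d \<noteq> e"
    using card by (auto simp: card_3_iff)
  have "distinct [a, b, c, d, e]" using R K disj by auto
  moreover have "P = {a, b} \<times> {c, d, e}" using prod unfolding R(1) K(1) .
  ultimately show "\<exists>a b c d e. distinct [a, b, c, d, e] \<and> P = {a, b} \<times> {c, d, e}"
    by blast
next
  assume "\<exists>a b c d e. distinct [a, b, c, d, e] \<and> P = {a, b} \<times> {c, d, e}"
  then obtain a b c d e where *: "distinct [a, b, c, d, e]" "P = {a, b} \<times> {c, d, e}" by blast
  then have "row_colors P = {a, b}" "col_colors P = {c, d, e}"
    by (auto simp: row_colors_def col_colors_def)
  then show "disjoint_K23 P" using * unfolding disjoint_K23_def by simp
qed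

text \<open>Listing the seven remaining cells over four named colors serves the same purpose here,
  and also makes transposition a direct computation.\<close>

lemma K33_minus_two_iff:
  "K33_minus_two P \<longleftrightarrow> (\<exists>a b x y. distinct [a, b, x, y] \<and>
    P = {(a, b), (a, y), (b, a), (b, y), (x, a), (x, b), (x, y)})"
proof
  assume "K33_minus_two P"
  then obtain a b x y where d: "a \<noteq> b" "x \<noteq> y" "x \<notin> {a, b}" "y \<notin> {a, b}"
    and P: "row_colors P = {a, b, x}" "col_colors P = {a, b, y}"
      "P = row_colors P \<times> col_colors P - {(a, a), (b, b)}"
    unfolding K33_minus_two_def by (elim exE conjE) (rule that)
  have "P = {a, b, x} \<times> {a, b, y} - {(a, a), (b, b)}" using P(3) unfolding P(1,2) .
  also have "\<dots> = {(a, b), (a, y), (b, a), (b, y), (x, a), (x, b), (x, y)}" using d by auto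
  finally have "P = {(a, b), (a, y), (b, a), (b, y), (x, a), (x, b), (x, y)}" .
  moreover have "distinct [a, b, x, y]" using d by auto
  ultimately show "\<exists>a b x y. distinct [a, b, x, y] \<and>
      P = {(a, b), (a, y), (b, a), (b, y), (x, a), (x, b), (x, y)}"
    by blast
next
  assume "\<exists>a b x y. distinct [a, b, x, y] \<and>
    P = {(a, b), (a, y), (b, a), (b, y), (x, a), (x, b), (x, y)}"
  then obtain a b x y where d: "distinct [a, b, x, y]"
    and P: "P = {(a, b), (a, y), (b, a), (b, y), (x, a), (x, b), (x, y)}" by blast
  have colors: "row_colors P = {a, b, x}" "col_colors P = {a, b, y}"
    using P by (auto simp: row_colors_def col_colors_def)
  have cells: "P = row_colors P \<times> col_colors P - {(a, a), (b, b)}"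
    unfolding colors using d P by auto
  have "a \<noteq> b" "x \<noteq> y" "x \<notin> {a, b}" "y \<notin> {a, b}" using d by auto
  then show "K33_minus_two P"
    unfolding K33_minus_two_def using colors cells by metis
qed

lemma disjoint_K23_relabel:
  assumes "disjoint_K23 P" "inj_on f (row_colors P \<union> col_colors P)"
  shows "disjoint_K23 (relabel f P)"
proof -
  obtain a b c d e where P: "distinct [a, b, c, d, e]" "P = {a, b} \<times> {c, d, e}"
    using assms(1) unfolding disjoint_K23_iff by blast
  have "row_colors P \<union> col_colors P = {a, b, c, d, e}"
    unfolding P(2) row_colors_def col_colors_def by auto
  then have "inj_on f {a, b, c, d, e}" using assms(2) by simp
  then have "distinct [f a, f b, f c, f d, f e]"
    using P(1) unfolding inj_on_def by auto
  moreover have "relabel f P = {f a, f b} \<times> {f c, f d, f e}" using P by (auto simp: relabel_def)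
  ultimately show ?thesis unfolding disjoint_K23_iff by blast
qed

lemma K33_minus_two_relabel:
  assumes "K33_minus_two P" "inj_on f (row_colors P \<union> col_colors P)"
  shows "K33_minus_two (relabel f P)"
proof -
  obtain a b x y where P: "distinct [a, b, x, y]"
      "P = {(a, b), (a, y), (b, a), (b, y), (x, a), (x, b), (x, y)}"
    using assms(1) unfolding K33_minus_two_iff by blast
  then have "row_colors P \<union> col_colors P = {a, b, x, y}"
    by (auto simp: row_colors_def col_colors_def)
  then have "distinct [f a, f b, f x, f y]" using P assms(2) by (auto simp: inj_on_def)
  moreover have "relabel f P = {(f a, f b), (f a, f y), (f b, f a), (f b, f y),
      (f x, f a), (f x, f b), (f x, f y)}"
    using P by (simp add: relabel_def)
  ultimately show ?thesis unfolding K33_minus_two_iff by blast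
qed

text \<open>Transposition exchanges the roles of \<open>x\<close> and \<open>y\<close> and fixes
  those of \<open>a\<close> and \<open>b\<close>. Hence this type, unlike
  \<open>disjoint_K23\<close>, needs no separate transposed alternative.\<close>

lemma K33_minus_two_converse:
  assumes "K33_minus_two P"
  shows "K33_minus_two (P\<inverse>)"
proof -
  obtain a b x y where P: "distinct [a, b, x, y]"
      "P = {(a, b), (a, y), (b, a), (b, y), (x, a), (x, b), (x, y)}"
    using assms unfolding K33_minus_two_iff by blast
  have "distinct [a, b, y, x]" using P(1) by auto
  moreover have "P\<inverse> = {(a, b), (a, x), (b, a), (b, x), (y, a), (y, b), (y, x)}"
    unfolding P(2) by auto
  ultimately show ?thesis unfolding K33_minus_two_iff by blast
qed

section \<open>The extremal types are bicyclic and attain 11\<close>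

text \<open>In either orientation \<open>P\<close> is a full product of disjoint color sets of sizes
  2 and 3: every row and column is full, and there are 6 edges, 5 vertices and 5 colors.\<close>

lemma disjoint_K23_bicyclic:
  assumes "disjoint_K23 P \<or> disjoint_K23 (P\<inverse>)"
  shows "bicyclic P" and "num_edges P + num_colors P = 11"
proof -
  let ?R = "row_colors P" and ?K = "col_colors P"
  have prod: "P = ?R \<times> ?K"
    using assms unfolding disjoint_K23_def by (metis converse_Times converse_converse
      row_colors_converse col_colors_converse)
  have disj: "?R \<inter> ?K = {}"
    and card: "card ?R = 2 \<and> card ?K = 3 \<or> card ?R = 3 \<and> card ?K = 2"
    using assms by (auto simp: disjoint_K23_def)
  have fin: "finite ?R" "finite ?K" using card by (auto intro: card_ge_0_finite)
  have edges: "num_edges P = 6"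
    unfolding num_edges_def by (subst prod) (use card in \<open>auto simp: card_cartesian_product\<close>)
  obtain x y where "x \<in> ?R" "y \<in> ?K" using card by fastforce
  then have "connected (with_proj (config_graph P))"
    by (intro connected_config_graphI[of x P y]) (use prod in blast)+
  moreover have "two_spine_config P"
    unfolding two_spine_config_def
  proof
    show "finite P" using fin by (subst prod) simp
    show "\<forall>(x, y) \<in> P. x \<noteq> y" using disj by (subst prod) auto
  qed
  ultimately show "bicyclic P" using card edges by (auto simp: bicyclic_def num_verts_def)
  show "num_edges P + num_colors P = 11"
    using card edges disj fin by (auto simp: num_colors_def card_Un_disjoint)
qed

lemma K33_minus_two_bicyclic:
  assumes "K33_minus_two P"
  shows "bicyclic P" and "num_edges P + num_colors P = 11"
proof -
  obtain a b x y where d: "distinct [a, b, x, y]"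
    and P: "P = {(a, b), (a, y), (b, a), (b, y), (x, a), (x, b), (x, y)}"
    using assms unfolding K33_minus_two_iff by blast
  have colors: "row_colors P = {a, b, x}" "col_colors P = {a, b, y}"
    using P by (auto simp: row_colors_def col_colors_def)
  have "connected (with_proj (config_graph P))"
    \<comment> \<open>Both deleted cells lie in rows and columns \<open>a\<close>, \<open>b\<close>,
      so row \<open>x\<close> and column \<open>y\<close> are full.\<close>
    by (rule connected_config_graphI[of x P y]) (unfold colors, simp_all add: P)
  moreover have "two_spine_config P" using d P by (auto simp: two_spine_config_def)
  moreover have "num_edges P = 7" using d by (simp add: num_edges_def P)
  moreover have "num_verts P = 6" using d by (simp add: num_verts_def colors)
  moreover have "num_colors P = 4" using d by (simp add: num_colors_def colors insert_commute)
  ultimately show "bicyclic P" "num_edges P + num_colors P = 11" by (simp_all add: bicyclic_def)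
qed

section \<open>The lower bound and the equality case\<close>

lemma bicyclic_bound:
  assumes "bicyclic P"
  shows "11 \<le> num_edges P + num_colors P"
    and "num_edges P + num_colors P = 11 \<Longrightarrow>
      disjoint_K23 P \<or> disjoint_K23 (P\<inverse>) \<or> K33_minus_two P"
proof -
  let ?R = "row_colors P" and ?K = "col_colors P"
  let ?r = "card ?R" and ?k = "card ?K" and ?i = "card (?R \<inter> ?K)" and ?s = "card (?R \<union> ?K)"
  have P: "two_spine_config P" and e: "card P = ?r + ?k + 1"
    using assms by (simp_all add: bicyclic_def num_edges_def num_verts_def)
  have fin: "finite ?R" "finite ?K"
    using P by (simp_all add: two_spine_config_def row_colors_def col_colors_def)
  have cells: "?r + ?k + 1 + ?i \<le> ?r * ?k" using card_config_le(1)[OF P] e by simp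
  have s: "?s + ?i = ?r + ?k" using card_Un_Int[OF fin] by simp
  have i: "?i \<le> ?r" "?i \<le> ?k" using fin by (simp_all add: card_mono)
  note bound = edge_color_bound[OF cells s i]
  show "11 \<le> num_edges P + num_colors P"
    using bound(1) e by (simp add: num_edges_def num_colors_def)
  assume "num_edges P + num_colors P = 11"
  then have "(?r, ?k, ?i) \<in> {(2, 3, 0), (3, 2, 0), (3, 3, 2)}"
    using bound(2) e by (simp add: num_edges_def num_colors_def)
  then consider "?r = 2" "?k = 3" "?i = 0" | "?r = 3" "?k = 2" "?i = 0" | "?r = 3" "?k = 3" "?i = 2"
    by auto
  then show "disjoint_K23 P \<or> disjoint_K23 (P\<inverse>) \<or> K33_minus_two P"
  proof cases
    case 1
    then have "?R \<inter> ?K = {}" using fin by simp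
    \<comment> \<open>The count is tight: \<open>card P = 2 + 3 + 1\<close>, and
      \<open>6 + 0 = 2 * 3\<close>.\<close>
    moreover have "P = ?R \<times> ?K - Id_on (?R \<inter> ?K)" using card_config_le(2)[OF P] e 1 by simp
    ultimately have "P = ?R \<times> ?K" by (metis Diff_empty Id_on_empty)
    then show ?thesis using 1 \<open>?R \<inter> ?K = {}\<close> unfolding disjoint_K23_def by blast
  next
    case 2
    then have disj: "?R \<inter> ?K = {}" using fin by simp
    moreover have "P = ?R \<times> ?K - Id_on (?R \<inter> ?K)" using card_config_le(2)[OF P] e 2 by simp
    ultimately have "P\<inverse> = ?K \<times> ?R" by (metis Diff_empty Id_on_empty converse_Times)
    then have "disjoint_K23 (P\<inverse>)"
      unfolding disjoint_K23_def row_colors_converse col_colors_converse using 2 disj by blast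
    then show ?thesis by blast
  next
    case 3
    \<comment> \<open>Here \<open>card P = 7\<close>, and \<open>7 + 2 = 3 * 3\<close> is tight
      again, so exactly the two diagonal cells are missing.\<close>
    have full: "P = ?R \<times> ?K - Id_on (?R \<inter> ?K)" using card_config_le(2)[OF P] e 3 by simp
    obtain a b where ab: "?R \<inter> ?K = {a, b}" "a \<noteq> b" using 3 by (auto simp: card_2_iff)
    \<comment> \<open>Beside the common colors \<open>a\<close>, \<open>b\<close> there is one
      private row color \<open>x\<close> and one private column color \<open>y\<close>; they differ,
      since a shared color would lie in the intersection.\<close>
    have "card (?R - ?R \<inter> ?K) = 1" "card (?K - ?R \<inter> ?K) = 1"
      using 3 fin by (simp_all add: card_Diff_subset)
    then obtain x y where xy: "?R - ?R \<inter> ?K = {x}" "?K - ?R \<inter> ?K = {y}"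
      by (metis card_1_singletonE)
    have "?R = {a, b, x}" "?K = {a, b, y}" using ab xy by blast+
    moreover have "x \<noteq> y" "x \<notin> {a, b}" "y \<notin> {a, b}" using ab xy by blast+
    moreover have "Id_on (?R \<inter> ?K) = {(a, a), (b, b)}" unfolding ab by auto
    then have "P = ?R \<times> ?K - {(a, a), (b, b)}" using full by metis
    ultimately have "K33_minus_two P" unfolding K33_minus_two_def using ab(2) by metis
    then show ?thesis by blast
  qed
qed

lemma bicyclic_eq_11_iff:
  "bicyclic P \<and> num_edges P + num_colors P = 11 \<longleftrightarrow>
    disjoint_K23 P \<or> disjoint_K23 (P\<inverse>) \<or> K33_minus_two P"
  using bicyclic_bound(2) disjoint_K23_bicyclic K33_minus_two_bicyclic by blast

section \<open>Classification up to equivalence\<close>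

text \<open>Both types survive relabeling, so an equivalence can only add transposes, and only
  \<open>disjoint_K23\<close> yields a new alternative that way.\<close>

lemma config_equiv_extremal_iff:
  fixes P :: "('a \<times> 'a) set"
  shows "(\<exists>Q :: ('a \<times> 'a) set. config_equiv P Q \<and> (disjoint_K23 Q \<or> K33_minus_two Q)) \<longleftrightarrow>
    disjoint_K23 P \<or> disjoint_K23 (P\<inverse>) \<or> K33_minus_two P"
proof
  assume "\<exists>Q :: ('a \<times> 'a) set. config_equiv P Q \<and> (disjoint_K23 Q \<or> K33_minus_two Q)"
  then obtain Q :: "('a \<times> 'a) set" where "config_equiv P Q"
    and Q: "disjoint_K23 Q \<or> K33_minus_two Q"
    by blast
  \<comment> \<open>Reversing the equivalence presents \<open>P\<close> as an image of the extremal
    \<open>Q\<close>, the direction of the relabeling lemmas.\<close>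
  from \<open>config_equiv P Q\<close> have "config_equiv Q P" by (rule config_equiv_sym)
  then obtain f where f: "inj_on f (row_colors Q \<union> col_colors Q)"
    and P: "P = relabel f Q \<or> P = (relabel f Q)\<inverse>"
    unfolding config_equiv_def relabel_converse by (elim exE conjE) (rule that)
  have "disjoint_K23 (relabel f Q) \<or> K33_minus_two (relabel f Q)"
    using Q disjoint_K23_relabel[OF _ f] K33_minus_two_relabel[OF _ f] by (elim disjE) simp_all
  then show "disjoint_K23 P \<or> disjoint_K23 (P\<inverse>) \<or> K33_minus_two P"
    using P K33_minus_two_converse by auto
next
  assume "disjoint_K23 P \<or> disjoint_K23 (P\<inverse>) \<or> K33_minus_two P"
  then show "\<exists>Q :: ('a \<times> 'a) set. config_equiv P Q \<and> (disjoint_K23 Q \<or> K33_minus_two Q)"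
    \<comment> \<open>The witness is \<open>P\<close> itself or its transpose.\<close>
    using config_equiv_refl[of P] config_equiv_converse[of P] by metis
qed

lemma disjoint_K23_unique:
  fixes Q :: "('a \<times> 'a) set" and Q' :: "('b \<times> 'b) set"
  assumes "disjoint_K23 Q" "disjoint_K23 Q'"
  shows "config_equiv Q Q'"
proof -
  obtain a b c d e where Q: "distinct [a, b, c, d, e]" "Q = {a, b} \<times> {c, d, e}"
    using assms(1) unfolding disjoint_K23_iff by blast
  obtain a' b' c' d' e' where Q': "distinct [a', b', c', d', e']" "Q' = {a', b'} \<times> {c', d', e'}"
    using assms(2) unfolding disjoint_K23_iff by blast
  \<comment> \<open>The default value \<open>a'\<close> supplies \<open>f a\<close>; values at
    colors outside \<open>Q\<close> are irrelevant to \<open>relabel\<close>.\<close>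
  define f where "f = (\<lambda>_. a')(b := b', c := c', d := d', e := e')"
  have f: "f a = a'" "f b = b'" "f c = c'" "f d = d'" "f e = e'"
    using Q(1) by (auto simp: f_def)
  have "row_colors Q \<union> col_colors Q = {a, b, c, d, e}"
    unfolding Q(2) row_colors_def col_colors_def by auto
  then have "inj_on f (row_colors Q \<union> col_colors Q)"
    using Q'(1) f by (auto simp: inj_on_def)
  moreover have "Q' = relabel f Q" unfolding Q(2) Q'(2) by (auto simp: relabel_def f)
  ultimately show ?thesis unfolding config_equiv_def by blast
qed

lemma K33_minus_two_unique:
  fixes Q :: "('a \<times> 'a) set" and Q' :: "('b \<times> 'b) set"
  assumes "K33_minus_two Q" "K33_minus_two Q'"
  shows "config_equiv Q Q'"
proof -
  obtain a b x y where Q: "distinct [a, b, x, y]"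
      "Q = {(a, b), (a, y), (b, a), (b, y), (x, a), (x, b), (x, y)}"
    using assms(1) unfolding K33_minus_two_iff by blast
  obtain a' b' x' y' where Q': "distinct [a', b', x', y']"
      "Q' = {(a', b'), (a', y'), (b', a'), (b', y'), (x', a'), (x', b'), (x', y')}"
    using assms(2) unfolding K33_minus_two_iff by blast
  define f where "f = (\<lambda>_. a')(b := b', x := x', y := y')"
  have f: "f a = a'" "f b = b'" "f x = x'" "f y = y'"
    using Q(1) by (auto simp: f_def)
  have "row_colors Q \<union> col_colors Q = {a, b, x, y}"
    unfolding Q(2) by (auto simp: row_colors_def col_colors_def)
  then have "inj_on f (row_colors Q \<union> col_colors Q)"
    using Q'(1) f by (auto simp: inj_on_def)
  moreover have "Q' = relabel f Q" unfolding Q(2) Q'(2) by (simp add: relabel_def f)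
  ultimately show ?thesis unfolding config_equiv_def by blast
qed

section \<open>Color counts that distinguish the two types\<close>

lemma num_colors_disjoint_K23:
  assumes "disjoint_K23 P"
  shows "num_colors P = 5"
proof -
  have "card (row_colors P) = 2" "card (col_colors P) = 3" "row_colors P \<inter> col_colors P = {}"
    using assms by (simp_all add: disjoint_K23_def)
  moreover from this have "finite (row_colors P)" "finite (col_colors P)"
    by (auto intro: card_ge_0_finite)
  ultimately show ?thesis by (simp add: num_colors_def card_Un_disjoint)
qed

lemma num_colors_K33_minus_two:
  assumes "K33_minus_two P"
  shows "num_colors P = 4"
proof -
  obtain a b x y where d: "distinct [a, b, x, y]"
    and P: "P = {(a, b), (a, y), (b, a), (b, y), (x, a), (x, b), (x, y)}"
    using assms unfolding K33_minus_two_iff by blast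
  have "row_colors P \<union> col_colors P = {a, b, x, y}"
    using P by (auto simp: row_colors_def col_colors_def)
  then show ?thesis using d by (simp add: num_colors_def)
qed

(* Attainment is stated over nat, since a small colour type 'a may lack enough colours. *)
theorem lemma4p2:
  shows
    "(\<exists>P :: (nat \<times> nat) set. bicyclic P \<and> num_edges P + num_colors P = 11) \<and>
     (\<forall>P :: ('a \<times> 'a) set. bicyclic P \<longrightarrow> 11 \<le> num_edges P + num_colors P) \<and>
     (\<forall>P :: ('a \<times> 'a) set.
        bicyclic P \<and> num_edges P + num_colors P = 11 \<longleftrightarrow>
        (\<exists>Q :: ('a \<times> 'a) set. config_equiv P Q \<and> (disjoint_K23 Q \<or> K33_minus_two Q))) \<and>
     (\<exists>Q :: (nat \<times> nat) set. disjoint_K23 Q) \<and>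
     (\<exists>Q :: (nat \<times> nat) set. K33_minus_two Q) \<and>
     (\<forall>(Q :: ('a \<times> 'a) set) (Q' :: ('b \<times> 'b) set).
        (disjoint_K23 Q \<and> disjoint_K23 Q') \<or> (K33_minus_two Q \<and> K33_minus_two Q')
        \<longrightarrow> config_equiv Q Q') \<and>
     (\<forall>(Q :: ('a \<times> 'a) set) (Q' :: ('b \<times> 'b) set).
        disjoint_K23 Q \<and> K33_minus_two Q' \<longrightarrow> \<not> config_equiv Q Q')"
proof (intro conjI allI impI)
  have K23: "disjoint_K23 ({0, 1} \<times> {2, 3, 4 :: nat})"
    unfolding disjoint_K23_iff
    by (rule exI[of _ 0], rule exI[of _ 1], rule exI[of _ 2], rule exI[of _ 3], rule exI[of _ 4]) simp
  then show "\<exists>Q :: (nat \<times> nat) set. disjoint_K23 Q" by blast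
  show "\<exists>P :: (nat \<times> nat) set. bicyclic P \<and> num_edges P + num_colors P = 11"
    using K23 disjoint_K23_bicyclic by blast
  have "distinct [0, 1, 2, 3 :: nat]" by simp
  then show "\<exists>Q :: (nat \<times> nat) set. K33_minus_two Q"
    unfolding K33_minus_two_iff by blast
next
  fix P :: "('a \<times> 'a) set"
  assume "bicyclic P"
  then show "11 \<le> num_edges P + num_colors P" by (rule bicyclic_bound(1))
next
  fix P :: "('a \<times> 'a) set"
  show "bicyclic P \<and> num_edges P + num_colors P = 11 \<longleftrightarrow>
      (\<exists>Q :: ('a \<times> 'a) set. config_equiv P Q \<and> (disjoint_K23 Q \<or> K33_minus_two Q))"
    unfolding bicyclic_eq_11_iff config_equiv_extremal_iff ..
next
  fix Q :: "('a \<times> 'a) set" and Q' :: "('b \<times> 'b) set"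
  assume "disjoint_K23 Q \<and> disjoint_K23 Q' \<or> K33_minus_two Q \<and> K33_minus_two Q'"
  then show "config_equiv Q Q'" using disjoint_K23_unique K33_minus_two_unique by blast
next
  fix Q :: "('a \<times> 'a) set" and Q' :: "('b \<times> 'b) set"
  assume Q: "disjoint_K23 Q \<and> K33_minus_two Q'"
  show "\<not> config_equiv Q Q'"
    \<comment> \<open>An equivalence would preserve the number of colors, which is 5 for
      \<open>Q\<close> and 4 for \<open>Q'\<close>.\<close>
    using Q num_colors_config_equiv[of Q Q'] num_colors_disjoint_K23[of Q]
      num_colors_K33_minus_two[of Q'] by auto
qed

end
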